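(* Let $r>0$, $s\in\mathbb N$, $a>0$. Then for any $q\in[1,\infty)$ such that $\lambda:=a-1/q>0$, and any $N\in\mathbb N$, $$d_N\bigl(U^{r,a}(\mathbb I^s,w),L_2(\mathbb I^s,w)\bigr)\ \le\ 2^r\,q^{r/(1+q)}\,\lambda^{-[qr/(1+q)]s}\,N^{-r/(1+q)}.$$
   Context: $\mathbb N=\{1,2,\dots\}$, $\mathbb N_0=\mathbb N\cup\{0\}$, $\mathbb I^s=[-1,1]^s$. Fix $\alpha,\beta>-1$ and let $a:=(\alpha+\beta+1)/2$, assumed positive. $L_2(\mathbb I^s,w)$ is the Hilbert space with inner product $(f,g)_w=\int_{\mathbb I^s}f(\mathbf x)g(\mathbf x)w(\mathbf x)\,d\mathbf x$, where $w(\mathbf x)=\prod_{j=1}^s(1-x_j)^\alpha(1+x_j)^\beta$. $\{P^{(\alpha,\beta)}_k\}_{k\ge0}$ are the orthonormal Jacobi polynomials on $[-1,1]$ for the weight $(1-x)^\alpha(1+x)^\beta$; $P^{(\alpha,\beta)}_{\mathbf k}(\mathbf x)=\prod_{j=1}^sP^{(\alpha,\beta)}_{k_j}(x_j)$ for $\mathbf k\in\mathbb N_0^s$, and $f_{\mathbf k}=(f,P^{(\alpha,\beta)}_{\mathbf k})_w$. With $\lambda_a(\mathbf k):=\prod_{j=1}^s(a+k_j)$, $K^{r,a}(\mathbb I^s,w)$ is the space of $f\in L_2(\mathbb I^s,w)$ with finite norm $\|f\|_{K^{r,a}(\mathbb I^s,w)}=\bigl(\sum_{\mathbf k\in\mathbb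 N_0^s}\lambda_a(\mathbf k)^{2r}|f_{\mathbf k}|^2\bigr)^{1/2}$, and $U^{r,a}(\mathbb I^s,w)$ is its (closed) unit ball. For a normed space $X$ and a centrally symmetric $W\subset X$, the Kolmogorov $N$-width is $d_N(W,X):=\inf_{L_N}\sup_{f\in W}\inf_{g\in L_N}\|f-g\|_X$, the outer infimum over all linear subspaces $L_N\subset X$ of dimension $\le N$. *)

theory Defs
  imports
    "HOL-Analysis.Analysis"
    "HOL-Library.Function_Algebras"
    "HOL-Computational_Algebra.Polynomial"
begin

text \<open>Real-valued functions as a real vector space, with pointwise operations.\<close>

instantiation "fun" :: (type, scaleR) scaleR
begin

definition scaleR_fun :: "real \<Rightarrow> ('a \<Rightarrow> 'b) \<Rightarrow> 'a \<Rightarrow> 'b" where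
  "scaleR_fun c f = (\<lambda>x. c *\<^sub>R f x)"

instance ..

end

instance "fun" :: (type, real_vector) real_vector
  by standard (auto simp: scaleR_fun_def fun_eq_iff scaleR_add_right scaleR_add_left)

text \<open>
  The Kolmogorov \<open>N\<close>-width of a set \<open>W\<close> in the space \<open>(X, nrm)\<close>.
  The type \<^typ>\<open>ereal\<close> accommodates an infinite supremum.
  The dimension bound is expressed by a finite spanning set, since
  \<^const>\<open>dim\<close> is \<open>0\<close> on infinite-dimensional subspaces.
  The function \<open>nrm\<close> may be a seminorm: subspaces spanned by at most \<open>N\<close> vectors of \<open>X\<close> are
  mapped onto the subspaces of dimension at most \<open>N\<close> of the quotient of \<open>X\<close> by the kernel
  of \<open>nrm\<close>, so the width is that of the image of \<open>W\<close> in this normed space.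
\<close>

definition kolmogorov_width ::
    "nat \<Rightarrow> 'v::real_vector set \<Rightarrow> 'v set \<Rightarrow> ('v \<Rightarrow> real) \<Rightarrow> ereal" where
  "kolmogorov_width N W X nrm =
     (INF L \<in> {L. L \<subseteq> X \<and> subspace L \<and> (\<exists>B. finite B \<and> card B \<le> N \<and> span B = L)}.
        SUP f \<in> W. INF g \<in> L. ereal (nrm (f - g)))"

text \<open>
  As \<^term>\<open>0 powr c = (0::real)\<close> for every \<open>c\<close>, the weights vanish at the
  endpoints (resp. the boundary of the cube), a null set.
\<close>

definition jacobi_weight1 :: "real \<Rightarrow> real \<Rightarrow> real \<Rightarrow> real" where
  "jacobi_weight1 \<alpha> \<beta> x = (1 - x) powr \<alpha> * (1 + x) powr \<beta>"

definition jacobi_weight :: "real \<Rightarrow> real \<Rightarrow> real ^ 's \<Rightarrow> real" where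
  "jacobi_weight \<alpha> \<beta> x = (\<Prod>j\<in>UNIV. jacobi_weight1 \<alpha> \<beta> (x $ j))"

definition cube :: "(real ^ 's) set" where
  "cube = {x. \<forall>j. x $ j \<in> {-1..1}}"

text \<open>
  \<open>L2w \<alpha> \<beta>\<close> consists of functions rather than classes modulo equality almost everywhere on the
  cube, so \<open>L2w_norm \<alpha> \<beta>\<close> is a seminorm on it whose quotient is the usual
  Hilbert space. Values outside the cube are irrelevant.
\<close>

definition L2w :: "real \<Rightarrow> real \<Rightarrow> (real ^ 's \<Rightarrow> real) set" where
  "L2w \<alpha> \<beta> = {f \<in> borel_measurable (lebesgue_on cube).
      integrable (lebesgue_on cube) (\<lambda>x. (f x)\<^sup>2 * jacobi_weight \<alpha> \<beta> x)}"

definition L2w_inner ::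
    "real \<Rightarrow> real \<Rightarrow> (real ^ 's \<Rightarrow> real) \<Rightarrow> (real ^ 's \<Rightarrow> real) \<Rightarrow> real" where
  "L2w_inner \<alpha> \<beta> f g = (LINT x|lebesgue_on cube. f x * g x * jacobi_weight \<alpha> \<beta> x)"

definition L2w_norm :: "real \<Rightarrow> real \<Rightarrow> (real ^ 's \<Rightarrow> real) \<Rightarrow> real" where
  "L2w_norm \<alpha> \<beta> f = sqrt (L2w_inner \<alpha> \<beta> f f)"

text \<open>
  For \<open>\<alpha>, \<beta> > -1\<close> these conditions are satisfied by exactly one sequence \<open>P\<close>, obtained from
  the monomials by Gram-Schmidt; the sign is fixed by the usual
  convention of a positive leading coefficient.
\<close>

definition orthonormal_jacobi_polys :: "real \<Rightarrow> real \<Rightarrow> (nat \<Rightarrow> real poly) \<Rightarrow> bool" where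
  "orthonormal_jacobi_polys \<alpha> \<beta> P \<longleftrightarrow>
     (\<forall>k. degree (P k) = k \<and> lead_coeff (P k) > 0) \<and>
     (\<forall>k l. (LINT x|lebesgue_on {-1..1}. poly (P k) x * poly (P l) x * jacobi_weight1 \<alpha> \<beta> x)
              = (if k = l then 1 else 0))"

definition tensor_poly :: "(nat \<Rightarrow> real poly) \<Rightarrow> nat ^ 's \<Rightarrow> real ^ 's \<Rightarrow> real" where
  "tensor_poly P k x = (\<Prod>j\<in>UNIV. poly (P (k $ j)) (x $ j))"

definition jacobi_coeff ::
    "real \<Rightarrow> real \<Rightarrow> (nat \<Rightarrow> real poly) \<Rightarrow> (real ^ 's \<Rightarrow> real) \<Rightarrow> nat ^ 's \<Rightarrow> real" where
  "jacobi_coeff \<alpha> \<beta> P f k = L2w_inner \<alpha> \<beta> f (tensor_poly P k)"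

definition hyp_weight :: "real \<Rightarrow> nat ^ 's \<Rightarrow> real" where
  "hyp_weight a k = (\<Prod>j\<in>UNIV. a + real (k $ j))"

definition K_space ::
    "real \<Rightarrow> real \<Rightarrow> real \<Rightarrow> real \<Rightarrow> (nat \<Rightarrow> real poly) \<Rightarrow> (real ^ 's \<Rightarrow> real) set" where
  "K_space r a \<alpha> \<beta> P = {f \<in> L2w \<alpha> \<beta>.
     (\<lambda>k. hyp_weight a k powr (2 * r) * \<bar>jacobi_coeff \<alpha> \<beta> P f k\<bar>\<^sup>2) summable_on UNIV}"

definition K_norm ::
    "real \<Rightarrow> real \<Rightarrow> real \<Rightarrow> real \<Rightarrow> (nat \<Rightarrow> real poly) \<Rightarrow> (real ^ 's \<Rightarrow> real) \<Rightarrow> real" where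
  "K_norm r a \<alpha> \<beta> P f =
     sqrt (\<Sum>\<^sub>\<infinity>k. hyp_weight a k powr (2 * r) * \<bar>jacobi_coeff \<alpha> \<beta> P f k\<bar>\<^sup>2)"

definition K_ball ::
    "real \<Rightarrow> real \<Rightarrow> real \<Rightarrow> real \<Rightarrow> (nat \<Rightarrow> real poly) \<Rightarrow> (real ^ 's \<Rightarrow> real) set" where
  "K_ball r a \<alpha> \<beta> P = {f \<in> K_space r a \<alpha> \<beta> P. K_norm r a \<alpha> \<beta> P f \<le> 1}"

end

(*
  Functions in the ball are approximated by their Jacobi partial sums over the hyperbolic cross
  of all k with hyp_weight a k \<le> T. By Parseval the error is at most T powr (-r); Parseval rests on
  the completeness of the tensor Jacobi polynomials, i.e. on the density of continuous functions
  in L2(w) combined with Stone-Weierstrass on the cube.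
  The cross has at most T powr (1 + q) * (\<Sum>j. (a + j) powr (-(1 + q))) ^ s elements. Convexity gives
  y powr (-(1 + q)) \<le> (y - 1/q) powr (-q) - (y + 1 - 1/q) powr (-q), so the series telescopes to at most
  lam powr (-q), and T = (N * lam powr (q * s)) powr (1 / (1 + q)) makes the bound equal to N. This proves
  the estimate even without the factors 2 powr r and q powr (r / (1 + q)), which are at least 1.
*)
theory Submission
  imports Defs
begin

subsection \<open>Counting the hyperbolic cross\<close>

text \<open>Bernoulli's inequality for a negative exponent. Both sides are compared with
  \<open>exp (q * x)\<close>, the right one through \<open>ln (1 - x) \<le> - x\<close>.\<close>

lemma bernoulli_powr_neg:
  fixes x q :: real
  assumes "x < 1" "q \<ge> 0"
  shows "1 + q * x \<le> (1 - x) powr (- q)"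
proof -
  have "q * x \<le> - q * ln (1 - x)"
    using ln_le_minus_one[of "1 - x"] assms mult_left_mono[of x "- ln (1 - x)" q] by simp
  have "1 + q * x \<le> exp (q * x)"
    by (rule exp_ge_add_one_self)
  also have "\<dots> \<le> (1 - x) powr (- q)"
    using assms \<open>q * x \<le> - q * ln (1 - x)\<close> by (simp add: powr_def)
  finally show ?thesis .
qed

text \<open>The graph of the convex function \<open>t powr (- q)\<close> lies above its tangent at
  \<open>y\<close>; a step of \<open>1 / q\<close> to the left cancels the factor \<open>q\<close>
  of the derivative and gains exactly \<open>y powr (- (1 + q))\<close>. The subtracted term is at
  most \<open>y powr (- q)\<close> because \<open>q \<ge> 1\<close> makes \<open>1 - 1 / q\<close>
  nonnegative.\<close>

lemma powr_telescope_bound: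
  fixes y q :: real
  assumes "q \<ge> 1" "y > 1 / q"
  shows "y powr (- (1 + q)) \<le> (y - 1 / q) powr (- q) - (y + 1 - 1 / q) powr (- q)"
proof -
  have y: "y > 0"
    using assms by (meson less_trans divide_pos_pos less_le_trans zero_less_one)
  have "1 / (q * y) < 1"
    using assms y by (simp add: field_simps)
  from bernoulli_powr_neg[OF this, of q]
  have "1 + 1 / y \<le> (1 - 1 / (q * y)) powr (- q)"
    using assms by simp
  then have "y powr (- q) * (1 + 1 / y) \<le> y powr (- q) * (1 - 1 / (q * y)) powr (- q)"
    by (rule mult_left_mono) simp
  also have "\<dots> = (y * (1 - 1 / (q * y))) powr (- q)"
    using \<open>1 / (q * y) < 1\<close> y by (subst powr_mult) auto
  also have "y * (1 - 1 / (q * y)) = y - 1 / q"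
    using y assms by (simp add: field_simps)
  finally have *: "y powr (- q) * (1 + 1 / y) \<le> (y - 1 / q) powr (- q)" .
  have "y powr (- (1 + q)) = y powr (- q) * (1 / y)"
    using y powr_add[of y "-1" "-q"] by (simp add: powr_minus field_simps)
  moreover have "(y + 1 - 1 / q) powr (- q) \<le> y powr (- q)"
    using assms y by (intro powr_mono2') (auto simp: field_simps)
  ultimately show ?thesis
    using * by (simp add: algebra_simps)
qed

text \<open>The right-hand side is free of \<open>n\<close>, so these partial sums stand in for the
  infinite series throughout.\<close>

lemma sum_powr_shift_le:
  fixes a q :: real
  assumes "q \<ge> 1" "a > 1 / q"
  shows "(\<Sum>k<n. (a + real k) powr (- (1 + q))) \<le> (a - 1 / q) powr (- q)"
proof -
  have "(\<Sum>k<n. (a + real k) powr (- (1 + q)))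
      \<le> (\<Sum>k<n. (a + real k - 1 / q) powr (- q) - (a + real (Suc k) - 1 / q) powr (- q))"
  proof (rule sum_mono)
    fix k
    show "(a + real k) powr (- (1 + q))
        \<le> (a + real k - 1 / q) powr (- q) - (a + real (Suc k) - 1 / q) powr (- q)"
      using powr_telescope_bound[of q "a + real k"] assms by (simp add: algebra_simps)
  qed
  also have "\<dots> = (a - 1 / q) powr (- q) - (a + real n - 1 / q) powr (- q)"
    using sum_lessThan_telescope'[of "\<lambda>k. (a + real k - 1 / q) powr (- q)" n] by simp
  also have "\<dots> \<le> (a - 1 / q) powr (- q)"
    by simp
  finally show ?thesis .
qed

lemma hyp_weight_pos: "a > 0 \<Longrightarrow> hyp_weight a k > 0"
  unfolding hyp_weight_def by (intro prod_pos) (auto intro: add_pos_nonneg)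

text \<open>A finite \<open>K\<close> fits into a box of multi-indices, over which the sum of
  products factors into a power of the one-dimensional sum. The bound is uniform in
  \<open>K\<close>.\<close>

lemma sum_hyp_weight_powr_le:
  fixes a q :: real and K :: "(nat ^ 's) set"
  assumes "q \<ge> 1" "a > 1 / q" "finite K"
  shows "(\<Sum>k\<in>K. hyp_weight a k powr (- (1 + q))) \<le> (a - 1 / q) powr (- (q * real CARD('s)))"
proof -
  have a: "a > 0"
    using assms by (meson less_trans divide_pos_pos less_le_trans zero_less_one)
  \<comment> \<open>A crude side length for the box: the sum of all entries of all members of
    \<open>K\<close> bounds each single entry, and \<open>Suc\<close> makes the inequality
    strict.\<close>
  define n where "n = Suc (\<Sum>k\<in>K. \<Sum>j\<in>UNIV. k $ j)"
  define E where "E = (UNIV :: 's set) \<rightarrow>\<^sub>E {..<n}"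
  have fin: "finite E"
    unfolding E_def by (intro finite_PiE) auto
  have sub: "K \<subseteq> vec_lambda ` E"
  proof
    fix k assume k: "k \<in> K"
    have "k $ j < n" for j
    proof -
      have "k $ j \<le> (\<Sum>j\<in>UNIV. k $ j)"
        by (rule member_le_sum) auto
      also have "\<dots> \<le> (\<Sum>k\<in>K. \<Sum>j\<in>UNIV. k $ j)"
        using k assms by (intro member_le_sum) auto
      finally show ?thesis by (simp add: n_def)
    qed
    then have "vec_nth k \<in> E" by (auto simp: E_def)
    then show "k \<in> vec_lambda ` E" by (metis image_eqI vec_nth_inverse)
  qed
  have "(\<Sum>k\<in>K. hyp_weight a k powr (- (1 + q)))
      \<le> (\<Sum>k\<in>vec_lambda ` E. hyp_weight a k powr (- (1 + q)))"
    using fin sub by (intro sum_mono2) auto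
  also have "\<dots> = (\<Sum>g\<in>E. hyp_weight a (vec_lambda g) powr (- (1 + q)))"
    by (subst sum.reindex) (auto simp: inj_on_def vec_lambda_inject)
  also have "\<dots> = (\<Sum>g\<in>E. \<Prod>j\<in>UNIV. (a + real (g j)) powr (- (1 + q)))"
    unfolding hyp_weight_def using a
    by (intro sum.cong refl) (simp add: prod_powr_distrib)
  also have "\<dots> = (\<Prod>j\<in>(UNIV :: 's set). \<Sum>k<n. (a + real k) powr (- (1 + q)))"
    unfolding E_def by (subst prod_sum_PiE) auto
  also have "\<dots> = (\<Sum>k<n. (a + real k) powr (- (1 + q))) ^ CARD('s)"
    by simp
  also have "\<dots> \<le> ((a - 1 / q) powr (- q)) ^ CARD('s)"
    using assms by (intro power_mono sum_powr_shift_le sum_nonneg) auto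
  also have "\<dots> = (a - 1 / q) powr (- (q * real CARD('s)))"
    using assms by (subst powr_realpow[symmetric]) (auto simp: powr_powr)
  finally show ?thesis .
qed

text \<open>Rankin's trick: every \<open>k\<close> with weight at most \<open>T\<close> contributes
  at least 1 to the sum of \<open>(T / hyp_weight a k) powr (1 + q)\<close>.\<close>

lemma card_hyperbolic_cross_le:
  fixes a q T :: real and K :: "(nat ^ 's) set"
  assumes "q \<ge> 1" "a > 1 / q" "finite K" "\<And>k. k \<in> K \<Longrightarrow> hyp_weight a k \<le> T"
  shows "real (card K) \<le> T powr (1 + q) * (a - 1 / q) powr (- (q * real CARD('s)))"
proof -
  have a: "a > 0"
    using assms by (meson less_trans divide_pos_pos less_le_trans zero_less_one)
  have "1 \<le> T powr (1 + q) * hyp_weight a k powr (- (1 + q))" if "k \<in> K" for k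
    using hyp_weight_pos[OF a, of k] assms(1) assms(4)[OF that] powr_mono2[of "1 + q" "hyp_weight a k" T]
    unfolding powr_minus_divide by simp
  then have "real (card K) \<le> (\<Sum>k\<in>K. T powr (1 + q) * hyp_weight a k powr (- (1 + q)))"
    using sum_mono[of K "\<lambda>_. 1::real"] by simp
  also have "\<dots> \<le> T powr (1 + q) * (a - 1 / q) powr (- (q * real CARD('s)))"
    unfolding sum_distrib_left[symmetric]
    by (intro mult_left_mono sum_hyp_weight_powr_le assms) auto
  finally show ?thesis .
qed

text \<open>Finiteness comes first, from the uniform bound on the cardinality of all finite subsets;
  the count then applies to the whole cross.\<close>

lemma card_hyperbolic_cross:
  fixes a q T :: real
  assumes "q \<ge> 1" "a > 1 / q"
  shows "finite {k :: nat ^ 's. hyp_weight a k \<le> T}"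
    and "real (card {k :: nat ^ 's. hyp_weight a k \<le> T})
           \<le> T powr (1 + q) * (a - 1 / q) powr (- (q * real CARD('s)))"
proof -
  let ?C = "T powr (1 + q) * (a - 1 / q) powr (- (q * real CARD('s)))"
  show fin: "finite {k :: nat ^ 's. hyp_weight a k \<le> T}"
  proof (rule conjunct1[OF finite_if_finite_subsets_card_bdd[of _ "nat \<lfloor>?C\<rfloor>"]])
    fix K assume "K \<subseteq> {k :: nat ^ 's. hyp_weight a k \<le> T}" "finite K"
    then show "card K \<le> nat \<lfloor>?C\<rfloor>"
      using card_hyperbolic_cross_le[OF assms, of K T] by (auto intro: le_nat_floor)
  qed
  show "real (card {k :: nat ^ 's. hyp_weight a k \<le> T}) \<le> ?C"
    using card_hyperbolic_cross_le[OF assms fin] by simp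
qed

subsection \<open>Integration over the cube\<close>

text \<open>Passes from the completed measure restricted to \<open>S\<close> to
  \<open>lborel\<close>, where product measures are available. For Borel \<open>h\<close> neither
  completion nor restriction changes the integral, apart from the indicator.\<close>

lemma integrable_lebesgue_on_borel_iff:
  fixes h :: "'a::euclidean_space \<Rightarrow> real"
  assumes [measurable]: "h \<in> borel_measurable borel" "S \<in> sets borel"
  shows "integrable (lebesgue_on S) h \<longleftrightarrow> integrable lborel (\<lambda>x. indicator S x * h x)"
    and "integral\<^sup>L (lebesgue_on S) h = (LINT x|lborel. indicator S x * h x)"
proof -
  have S: "S \<inter> space lebesgue \<in> sets lebesgue"
    using assms by simp
  have m: "(\<lambda>x. indicator S x *\<^sub>R h x) \<in> borel_measurable lborel"
    by measurable
  show "integrable (lebesgue_on S) h \<longleftrightarrow> integrable lborel (\<lambda>x. indicator S x * h x)"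
    using integrable_restrict_space[OF S, of h] integrable_completion[OF m] by simp
  show "integral\<^sup>L (lebesgue_on S) h = (LINT x|lborel. indicator S x * h x)"
    using integral_restrict_space[OF S, of h] integral_completion[OF m] by simp
qed

text \<open>By \<open>lborel_eq\<close>, \<open>lborel\<close> is the image of a product of
  one-dimensional measures under the coordinate map, so Fubini for products of one-variable
  functions carries over.\<close>

lemma lborel_prod_Basis:
  fixes f :: "'a::euclidean_space \<Rightarrow> real \<Rightarrow> real"
  assumes "\<And>b. b \<in> Basis \<Longrightarrow> integrable lborel (f b)"
  shows "integrable lborel (\<lambda>x. \<Prod>b\<in>Basis. f b (x \<bullet> b))"
    and "(LINT x|lborel. (\<Prod>b\<in>Basis. f b (x \<bullet> b))) = (\<Prod>b\<in>Basis. integral\<^sup>L lborel (f b))"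
proof -
  interpret product_sigma_finite "\<lambda>_::'a. lborel :: real measure"
    by standard
  have [measurable]: "f b \<in> borel_measurable borel" if "b \<in> Basis" for b
    using borel_measurable_integrable[OF assms[OF that]] by simp
  have m: "(\<lambda>x. \<Prod>b\<in>Basis. f b (x \<bullet> b)) \<in> borel_measurable borel"
    by measurable
  have g: "(\<lambda>f. \<Sum>b\<in>Basis. f b *\<^sub>R b) \<in> (\<Pi>\<^sub>M b\<in>(Basis::'a set). (lborel :: real measure)) \<rightarrow>\<^sub>M borel"
    by measurable
  show "integrable lborel (\<lambda>x. \<Prod>b\<in>Basis. f b (x \<bullet> b))"
    by (subst lborel_eq, subst integrable_distr_eq[OF g m])
       (use product_integrable_prod[of Basis f] assms in simp)
  show "(LINT x|lborel. (\<Prod>b\<in>Basis. f b (x \<bullet> b))) = (\<Prod>b\<in>Basis. integral\<^sup>L lborel (f b))"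
    by (subst lborel_eq, subst integral_distr[OF g m])
       (use product_integral_prod[of Basis f] assms in simp)
qed

text \<open>\<open>SOME\<close> recovers the coordinate belonging to a basis vector; it is unique
  since \<open>axis j 1\<close> determines \<open>j\<close>.\<close>

lemma prod_Basis_cart:
  fixes f :: "'s::finite \<Rightarrow> 'b::comm_monoid_mult"
  shows "(\<Prod>b\<in>(Basis :: (real ^ 's) set). f (SOME j. b = axis j 1)) = (\<Prod>j\<in>UNIV. f j)"
proof -
  have "bij_betw (\<lambda>j. axis j (1::real)) (UNIV :: 's set) Basis"
    by (auto simp: bij_betw_def inj_on_def axis_eq_axis Basis_vec_def)
  moreover have "(SOME i. axis j (1::real) = axis i 1) = j" for j :: 's
    by (auto simp: axis_eq_axis)
  ultimately show ?thesis
    using prod.reindex_bij_betw[of "\<lambda>j. axis j (1::real)" "UNIV :: 's set" Basis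
        "\<lambda>b. f (SOME j. b = axis j 1)"] by simp
qed

lemma lborel_prod_cart:
  fixes f :: "'s::finite \<Rightarrow> real \<Rightarrow> real"
  assumes "\<And>j. integrable lborel (f j)"
  shows "integrable lborel (\<lambda>x::real ^ 's. \<Prod>j\<in>UNIV. f j (x $ j))"
    and "(LINT x|lborel. (\<Prod>j\<in>UNIV. f j ((x::real ^ 's) $ j))) = (\<Prod>j\<in>UNIV. integral\<^sup>L lborel (f j))"
proof -
  let ?s = "\<lambda>b::real ^ 's. SOME j. b = axis j 1"
  have *: "(\<Prod>b\<in>Basis. f (?s b) (x \<bullet> b)) = (\<Prod>j\<in>UNIV. f j (x $ j))" for x :: "real ^ 's"
  proof -
    have "(\<Prod>b\<in>Basis. f (?s b) (x \<bullet> b)) = (\<Prod>b\<in>Basis. f (?s b) (x $ ?s b))"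
    proof (rule prod.cong[OF refl])
      fix b :: "real ^ 's" assume "b \<in> Basis"
      then have "\<exists>j. b = axis j 1" by (auto simp: Basis_vec_def)
      then have "b = axis (?s b) 1" by (rule someI_ex)
      then show "f (?s b) (x \<bullet> b) = f (?s b) (x $ ?s b)"
        by (metis inner_axis inner_real_def mult.right_neutral)
    qed
    then show ?thesis
      using prod_Basis_cart[of "\<lambda>j. f j (x $ j)"] by simp
  qed
  show "integrable lborel (\<lambda>x::real ^ 's. \<Prod>j\<in>UNIV. f j (x $ j))"
    using lborel_prod_Basis(1)[of "\<lambda>b. f (?s b)"] assms by (simp add: *)
  show "(LINT x|lborel. (\<Prod>j\<in>UNIV. f j ((x::real ^ 's) $ j))) = (\<Prod>j\<in>UNIV. integral\<^sup>L lborel (f j))"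
    using lborel_prod_Basis(2)[of "\<lambda>b. f (?s b)"] assms
      prod_Basis_cart[of "\<lambda>j. integral\<^sup>L lborel (f j)"] by (simp add: *)
qed

lemma cube_eq_cbox: "cube = cbox (\<chi> j. -1) (\<chi> j. 1)"
  by (auto simp: cube_def mem_box_cart)

lemma compact_cube: "compact cube"
  by (simp add: cube_eq_cbox)

lemma cube_borel [measurable]: "cube \<in> sets borel"
  by (simp add: cube_eq_cbox)

text \<open>The indicator of the cube is the product of the indicators of the sides, so the
  restricted integrand is again a product over the coordinates.\<close>

lemma cube_prod:
  fixes f :: "'s::finite \<Rightarrow> real \<Rightarrow> real"
  assumes [measurable]: "\<And>j. f j \<in> borel_measurable borel"
    and int: "\<And>j. integrable (lebesgue_on {-1..1}) (f j)"
  shows "integrable (lebesgue_on cube) (\<lambda>x::real ^ 's. \<Prod>j\<in>UNIV. f j (x $ j))"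
    and "(LINT x|lebesgue_on cube. (\<Prod>j\<in>UNIV. f j ((x::real ^ 's) $ j)))
           = (\<Prod>j\<in>UNIV. integral\<^sup>L (lebesgue_on {-1..1}) (f j))"
proof -
  have m: "(\<lambda>x::real ^ 's. \<Prod>j\<in>UNIV. f j (x $ j)) \<in> borel_measurable borel"
    by measurable
  have ind: "indicator cube x * (\<Prod>j\<in>UNIV. f j (x $ j))
      = (\<Prod>j\<in>UNIV. indicator {-1..1} (x $ j) * f j (x $ j))" for x :: "real ^ 's"
  proof (cases "x \<in> cube")
    case False
    then obtain j where "x $ j \<notin> {-1..1}" by (auto simp: cube_def)
    then have "indicator {-1..1} (x $ j) * f j (x $ j) = 0" by simp
    then have "(\<Prod>j\<in>UNIV. indicator {-1..1} (x $ j) * f j (x $ j)) = 0"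
      by (metis UNIV_I finite prod_zero)
    then show ?thesis using False by simp
  next
    case True
    then have "x $ j \<in> {-1..1}" for j by (auto simp: cube_def)
    then show ?thesis using True by (simp add: indicator_def)
  qed
  have int': "integrable lborel (\<lambda>y. indicator {-1..1} y * f j y)" for j
    using int[of j] by (subst (asm) integrable_lebesgue_on_borel_iff) auto
  show "integrable (lebesgue_on cube) (\<lambda>x::real ^ 's. \<Prod>j\<in>UNIV. f j (x $ j))"
    using lborel_prod_cart(1)[of "\<lambda>j y. indicator {-1..1} y * f j y"] int'
    by (subst integrable_lebesgue_on_borel_iff[OF m cube_borel]) (simp add: ind)
  show "(LINT x|lebesgue_on cube. (\<Prod>j\<in>UNIV. f j ((x::real ^ 's) $ j)))
           = (\<Prod>j\<in>UNIV. integral\<^sup>L (lebesgue_on {-1..1}) (f j))"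
    using lborel_prod_cart(2)[of "\<lambda>j y. indicator {-1..1} y * f j y"] int'
    by (subst integrable_lebesgue_on_borel_iff(2)[OF m cube_borel])
       (simp add: ind integrable_lebesgue_on_borel_iff(2))
qed

section \<open>The Jacobi weight, its measure on the cube, and orthonormality of the tensor
  polynomials\<close>

lemma jacobi_weight1_measurable [measurable]: "jacobi_weight1 \<alpha> \<beta> \<in> borel_measurable borel"
  unfolding jacobi_weight1_def by measurable

lemma jacobi_weight1_nonneg: "jacobi_weight1 \<alpha> \<beta> x \<ge> 0"
  by (simp add: jacobi_weight1_def)

lemma jacobi_weight_measurable_borel [measurable]: "jacobi_weight \<alpha> \<beta> \<in> borel_measurable borel"
  unfolding jacobi_weight_def by measurable

lemma jacobi_weight_measurable [measurable]:
  "jacobi_weight \<alpha> \<beta> \<in> borel_measurable (lebesgue_on S)"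
  by (intro measurable_restrict_space1 measurable_completion) simp

lemma jacobi_weight_nonneg: "jacobi_weight \<alpha> \<beta> x \<ge> 0"
  by (simp add: jacobi_weight_def prod_nonneg jacobi_weight1_nonneg)

lemma poly_measurable [measurable]: "poly (p :: real poly) \<in> borel_measurable borel"
  by (intro borel_measurable_continuous_onI continuous_intros)

text \<open>Read off from the normalisation of \<open>P 0\<close>, a nonzero constant: its square
  times the weight has integral 1.\<close>

lemma jacobi_weight1_integrable:
  assumes "orthonormal_jacobi_polys \<alpha> \<beta> P"
  shows "integrable (lebesgue_on {-1..1}) (jacobi_weight1 \<alpha> \<beta>)"
proof -
  have "degree (P 0) = 0" and pos: "lead_coeff (P 0) > 0"
    using assms unfolding orthonormal_jacobi_polys_def by blast+
  then obtain c where c: "P 0 = [:c:]"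
    by (meson degree_eq_zeroE)
  with pos have "c \<noteq> 0"
    by simp
  have "(LINT x|lebesgue_on {-1..1}. poly (P 0) x * poly (P 0) x * jacobi_weight1 \<alpha> \<beta> x) = 1"
    using assms by (simp add: orthonormal_jacobi_polys_def)
  \<comment> \<open>A non-integrable function has Bochner integral 0 by convention, so the value 1
    forces integrability.\<close>
  then have "integrable (lebesgue_on {-1..1}) (\<lambda>x. poly (P 0) x * poly (P 0) x * jacobi_weight1 \<alpha> \<beta> x)"
    using not_integrable_integral_eq by fastforce
  then show ?thesis
    using c \<open>c \<noteq> 0\<close> by simp
qed

lemma poly_jacobi_weight1_integrable:
  assumes "integrable (lebesgue_on {-1..1}) (jacobi_weight1 \<alpha> \<beta>)"
  shows "integrable (lebesgue_on {-1..1}) (\<lambda>x. poly p x * jacobi_weight1 \<alpha> \<beta> x)"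
proof -
  have "bounded (poly p ` {-1..1})"
    by (intro compact_imp_bounded compact_continuous_image continuous_intros) auto
  then obtain B where B: "\<And>x. x \<in> {-1..1} \<Longrightarrow> \<bar>poly p x\<bar> \<le> B"
    unfolding bounded_iff by fastforce
  have m: "(\<lambda>x. poly p x * jacobi_weight1 \<alpha> \<beta> x) \<in> borel_measurable (lebesgue_on {-1..1})"
    by (intro measurable_restrict_space1 measurable_completion) simp
  show ?thesis
  proof (rule Bochner_Integration.integrable_bound[OF integrable_mult_right[OF assms, of B] m])
    show "AE x in lebesgue_on {-1..1}. norm (poly p x * jacobi_weight1 \<alpha> \<beta> x)
        \<le> norm (B * jacobi_weight1 \<alpha> \<beta> x)"
    proof (rule AE_I2)
      fix x :: real assume "x \<in> space (lebesgue_on {-1..1})"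
      then have "\<bar>poly p x\<bar> \<le> \<bar>B\<bar>" using B[of x] by (simp add: space_restrict_space)
      then show "norm (poly p x * jacobi_weight1 \<alpha> \<beta> x) \<le> norm (B * jacobi_weight1 \<alpha> \<beta> x)"
        by (simp add: abs_mult mult_right_mono)
    qed
  qed
qed

text \<open>Absorbing the weight into the measure turns \<open>L2w\<close> into an ordinary space of
  square-integrable functions, open to the general theorems on finite measures and dominated
  convergence.\<close>

definition jacobi_measure :: "real \<Rightarrow> real \<Rightarrow> (real ^ 's) measure" where
  "jacobi_measure \<alpha> \<beta> = density (lebesgue_on cube) (\<lambda>x. ennreal (jacobi_weight \<alpha> \<beta> x))"

lemma jacobi_measure_measurable_iff:
  "f \<in> borel_measurable (jacobi_measure \<alpha> \<beta>) \<longleftrightarrow> f \<in> borel_measurable (lebesgue_on cube)"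
  by (simp add: jacobi_measure_def)

lemma finite_measure_jacobi_measure:
  assumes "integrable (lebesgue_on {-1..1}) (jacobi_weight1 \<alpha> \<beta>)"
  shows "finite_measure (jacobi_measure \<alpha> \<beta> :: (real ^ 's) measure)"
proof
  have "integrable (lebesgue_on cube) (jacobi_weight \<alpha> \<beta> :: real ^ 's \<Rightarrow> real)"
    using cube_prod(1)[of "\<lambda>_. jacobi_weight1 \<alpha> \<beta>"] assms
    unfolding jacobi_weight_def by simp
  then have "(\<integral>\<^sup>+x. ennreal (jacobi_weight \<alpha> \<beta> (x :: real ^ 's)) \<partial>lebesgue_on cube) \<noteq> \<infinity>"
    by (subst nn_integral_eq_integral) (auto simp: jacobi_weight_nonneg)
  then show "emeasure (jacobi_measure \<alpha> \<beta> :: (real ^ 's) measure) (space (jacobi_measure \<alpha> \<beta>)) \<noteq> \<infinity>"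
    unfolding jacobi_measure_def
    by (subst emeasure_density) (auto simp: nn_integral_restrict_space mult.assoc indicator_inter_arith[symmetric])
qed

lemma L2w_iff:
  "f \<in> L2w \<alpha> \<beta> \<longleftrightarrow> f \<in> borel_measurable (jacobi_measure \<alpha> \<beta>)
     \<and> integrable (jacobi_measure \<alpha> \<beta>) (\<lambda>x. (f x)\<^sup>2)"
proof -
  have "integrable (jacobi_measure \<alpha> \<beta>) (\<lambda>x. (f x)\<^sup>2)
      \<longleftrightarrow> integrable (lebesgue_on cube) (\<lambda>x. (f x)\<^sup>2 * jacobi_weight \<alpha> \<beta> x)"
    if [measurable]: "f \<in> borel_measurable (lebesgue_on cube)"
    unfolding jacobi_measure_def
    by (subst integrable_density) (auto simp: jacobi_weight_nonneg mult.commute)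
  then show ?thesis
    unfolding L2w_def by (auto simp: jacobi_measure_measurable_iff)
qed

lemma L2w_inner_eq:
  assumes "f \<in> borel_measurable (jacobi_measure \<alpha> \<beta>)" "g \<in> borel_measurable (jacobi_measure \<alpha> \<beta>)"
  shows "L2w_inner \<alpha> \<beta> f g = (LINT x|jacobi_measure \<alpha> \<beta>. f x * g x)"
proof -
  have [measurable]: "f \<in> borel_measurable (lebesgue_on cube)" "g \<in> borel_measurable (lebesgue_on cube)"
    using assms by (simp_all add: jacobi_measure_measurable_iff)
  show ?thesis
    unfolding jacobi_measure_def L2w_inner_def
    by (subst integral_density) (auto simp: jacobi_weight_nonneg mult_ac)
qed

lemma tensor_poly_measurable_borel [measurable]: "tensor_poly P k \<in> borel_measurable borel"
  unfolding tensor_poly_def by measurable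

text \<open>The integrand splits over the coordinates, and a product of one-dimensional Kronecker
  deltas is the delta of the multi-indices. Integrability with \<open>k = l\<close> later yields
  membership in \<open>L2w\<close>.\<close>

lemma tensor_poly_inner:
  assumes "orthonormal_jacobi_polys \<alpha> \<beta> P"
  shows "integrable (lebesgue_on cube) (\<lambda>x::real ^ 's. tensor_poly P k x * tensor_poly P l x * jacobi_weight \<alpha> \<beta> x)"
    and "L2w_inner \<alpha> \<beta> (tensor_poly P k :: real ^ 's \<Rightarrow> real) (tensor_poly P l) = (if k = l then 1 else 0)"
proof -
  let ?f = "\<lambda>j x. poly (P (k $ j)) x * poly (P (l $ j)) x * jacobi_weight1 \<alpha> \<beta> x"
  have m: "?f j \<in> borel_measurable borel" for j
    by measurable
  have i: "integrable (lebesgue_on {-1..1}) (?f j)" for j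
    using poly_jacobi_weight1_integrable[OF jacobi_weight1_integrable[OF assms],
        of "P (k $ j) * P (l $ j)"] by simp
  have *: "tensor_poly P k x * tensor_poly P l x * jacobi_weight \<alpha> \<beta> x = (\<Prod>j\<in>UNIV. ?f j (x $ j))"
    for x :: "real ^ 's"
    by (simp add: tensor_poly_def jacobi_weight_def prod.distrib)
  show "integrable (lebesgue_on cube) (\<lambda>x::real ^ 's. tensor_poly P k x * tensor_poly P l x * jacobi_weight \<alpha> \<beta> x)"
    using cube_prod(1)[of ?f, OF m i] by (simp only: *)
  have "L2w_inner \<alpha> \<beta> (tensor_poly P k :: real ^ 's \<Rightarrow> real) (tensor_poly P l)
      = (\<Prod>j\<in>UNIV. integral\<^sup>L (lebesgue_on {-1..1}) (?f j))"
    using cube_prod(2)[of ?f, OF m i] unfolding L2w_inner_def by (simp only: *)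
  also have "\<dots> = (\<Prod>j\<in>UNIV. if k $ j = l $ j then 1 else 0)"
    using assms by (simp add: orthonormal_jacobi_polys_def)
  also have "\<dots> = (if k = l then 1 else 0)"
    by (auto simp: vec_eq_iff)
  finally show "L2w_inner \<alpha> \<beta> (tensor_poly P k :: real ^ 's \<Rightarrow> real) (tensor_poly P l) = (if k = l then 1 else 0)" .
qed

lemma tensor_poly_L2w:
  assumes "orthonormal_jacobi_polys \<alpha> \<beta> P"
  shows "(tensor_poly P k :: real ^ 's \<Rightarrow> real) \<in> L2w \<alpha> \<beta>"
proof -
  have "(tensor_poly P k :: real ^ 's \<Rightarrow> real) \<in> borel_measurable (lebesgue_on cube)"
    by (intro measurable_restrict_space1 measurable_completion) simp
  then show ?thesis
    using tensor_poly_inner(1)[OF assms, of k k] by (simp add: L2w_def power2_eq_square)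
qed

subsection \<open>Orthogonal expansions\<close>

lemma sum_fun_apply [simp]: "(\<Sum>i\<in>I. f i) x = (\<Sum>i\<in>I. f i x)" for f :: "'i \<Rightarrow> 'a \<Rightarrow> 'b::comm_monoid_add"
  by (induction I rule: infinite_finite_induct) auto

lemma scaleR_fun_apply [simp]: "(c *\<^sub>R f) x = c *\<^sub>R f x"
  by (simp add: scaleR_fun_def)

lemma L2w_mult_integrable:
  assumes "f \<in> L2w \<alpha> \<beta>" "g \<in> L2w \<alpha> \<beta>"
  shows "integrable (jacobi_measure \<alpha> \<beta>) (\<lambda>x. f x * g x)"
proof -
  let ?M = "jacobi_measure \<alpha> \<beta>"
  have [measurable]: "f \<in> borel_measurable ?M" "g \<in> borel_measurable ?M"
    and int: "integrable ?M (\<lambda>x. (f x)\<^sup>2 + (g x)\<^sup>2)"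
    using assms by (auto simp: L2w_iff)
  show ?thesis
  proof (rule Bochner_Integration.integrable_bound[OF int])
    show "AE x in ?M. norm (f x * g x) \<le> norm ((f x)\<^sup>2 + (g x)\<^sup>2)"
    proof (rule AE_I2)
      fix x
      have "2 * \<bar>f x * g x\<bar> \<le> (f x)\<^sup>2 + (g x)\<^sup>2"
        using sum_squares_bound[of "\<bar>f x\<bar>" "\<bar>g x\<bar>"] by (simp add: abs_mult)
      then show "norm (f x * g x) \<le> norm ((f x)\<^sup>2 + (g x)\<^sup>2)"
        by simp
    qed
  qed measurable
qed

lemma subspace_L2w: "subspace (L2w \<alpha> \<beta>)"
proof (rule subspaceI)
  show "0 \<in> L2w \<alpha> \<beta>"
    by (simp add: L2w_iff zero_fun_def)
  show "f + g \<in> L2w \<alpha> \<beta>" if "f \<in> L2w \<alpha> \<beta>" "g \<in> L2w \<alpha> \<beta>" for f g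
  proof -
    have "integrable (jacobi_measure \<alpha> \<beta>) (\<lambda>x. (f x)\<^sup>2 + (g x)\<^sup>2 + 2 * (f x * g x))"
      using that L2w_mult_integrable[OF that] by (auto simp: L2w_iff)
    then show ?thesis
      using that by (auto simp: L2w_iff power2_sum mult.assoc plus_fun_def)
  qed
  show "c *\<^sub>R f \<in> L2w \<alpha> \<beta>" if "f \<in> L2w \<alpha> \<beta>" for c f
    using that by (auto simp: L2w_iff scaleR_fun_def power_mult_distrib)
qed

lemma L2w_inner_commute: "L2w_inner \<alpha> \<beta> f g = L2w_inner \<alpha> \<beta> g f"
  by (simp add: L2w_inner_def mult.commute)

lemma L2w_inner_diff_left:
  assumes "f \<in> L2w \<alpha> \<beta>" "g \<in> L2w \<alpha> \<beta>" "h \<in> L2w \<alpha> \<beta>"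
  shows "L2w_inner \<alpha> \<beta> (f - g) h = L2w_inner \<alpha> \<beta> f h - L2w_inner \<alpha> \<beta> g h"
proof -
  have "f - g \<in> L2w \<alpha> \<beta>"
    by (intro subspace_diff[OF subspace_L2w] assms)
  then show ?thesis
    using assms L2w_mult_integrable[OF assms(1,3)] L2w_mult_integrable[OF assms(2,3)]
    by (simp add: L2w_inner_eq L2w_iff left_diff_distrib)
qed

lemma L2w_inner_scaled_sum_left:
  assumes "\<And>k. k \<in> K \<Longrightarrow> e k \<in> L2w \<alpha> \<beta>" "h \<in> L2w \<alpha> \<beta>"
  shows "L2w_inner \<alpha> \<beta> (\<Sum>k\<in>K. c k *\<^sub>R e k) h = (\<Sum>k\<in>K. c k * L2w_inner \<alpha> \<beta> (e k) h)"
proof -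
  have "(\<Sum>k\<in>K. c k *\<^sub>R e k) \<in> L2w \<alpha> \<beta>"
    by (intro subspace_sum[OF subspace_L2w] subspace_scale[OF subspace_L2w] assms)
  then have "L2w_inner \<alpha> \<beta> (\<Sum>k\<in>K. c k *\<^sub>R e k) h
      = (LINT x|jacobi_measure \<alpha> \<beta>. (\<Sum>k\<in>K. c k * (e k x * h x)))"
    using assms by (simp add: L2w_inner_eq L2w_iff sum_distrib_right mult.assoc)
  also have "\<dots> = (\<Sum>k\<in>K. LINT x|jacobi_measure \<alpha> \<beta>. c k * (e k x * h x))"
    using assms by (intro Bochner_Integration.integral_sum integrable_mult_right L2w_mult_integrable) auto
  also have "\<dots> = (\<Sum>k\<in>K. c k * L2w_inner \<alpha> \<beta> (e k) h)"
    using assms by (intro sum.cong refl) (simp add: L2w_inner_eq L2w_iff)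
  finally show ?thesis .
qed

text \<open>Completing the square, for arbitrary coefficients \<open>c\<close>. With
  \<open>c\<close> the Fourier coefficients the last sum vanishes; for any other \<open>c\<close> it
  is the nonnegative excess over the best approximation. Both cases are used later.\<close>

lemma L2w_inner_residual:
  fixes c :: "'i \<Rightarrow> real"
  assumes f: "f \<in> L2w \<alpha> \<beta>" and e: "\<And>k. e k \<in> L2w \<alpha> \<beta>"
    and on: "\<And>k l. L2w_inner \<alpha> \<beta> (e k) (e l) = (if k = l then 1 else 0)"
    and K: "finite K"
  defines "g \<equiv> (\<Sum>k\<in>K. c k *\<^sub>R e k)"
  shows "L2w_inner \<alpha> \<beta> (f - g) (f - g) = L2w_inner \<alpha> \<beta> f f
      - (\<Sum>k\<in>K. (L2w_inner \<alpha> \<beta> f (e k))\<^sup>2) + (\<Sum>k\<in>K. (c k - L2w_inner \<alpha> \<beta> f (e k))\<^sup>2)"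
proof -
  let ?i = "L2w_inner \<alpha> \<beta>"
  have g: "g \<in> L2w \<alpha> \<beta>"
    unfolding g_def by (intro subspace_sum[OF subspace_L2w] subspace_scale[OF subspace_L2w] e)
  have fg: "f - g \<in> L2w \<alpha> \<beta>"
    by (intro subspace_diff[OF subspace_L2w] f g)
  have gh: "?i g h = (\<Sum>k\<in>K. c k * ?i (e k) h)" if "h \<in> L2w \<alpha> \<beta>" for h
    unfolding g_def using that e by (intro L2w_inner_scaled_sum_left)
  have "?i (e k) g = (if k \<in> K then c k else 0)" for k
    using gh[OF e, of k] K by (subst L2w_inner_commute) (simp add: on if_distrib cong: if_cong)
  then have gg: "?i g g = (\<Sum>k\<in>K. (c k)\<^sup>2)"
    using gh[OF g] by (simp add: power2_eq_square)
  have gf: "?i g f = (\<Sum>k\<in>K. c k * ?i f (e k))"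
    using gh[OF f] by (simp add: L2w_inner_commute)
  have "?i (f - g) (f - g) = ?i f (f - g) - ?i g (f - g)"
    by (rule L2w_inner_diff_left[OF f g fg])
  also have "\<dots> = ?i f f - 2 * ?i g f + ?i g g"
    using L2w_inner_diff_left[OF f g f] L2w_inner_diff_left[OF f g g]
      L2w_inner_commute[of \<alpha> \<beta> f "f - g"] L2w_inner_commute[of \<alpha> \<beta> g "f - g"]
      L2w_inner_commute[of \<alpha> \<beta> f g] by linarith
  also have "\<dots> = ?i f f - (\<Sum>k\<in>K. (?i f (e k))\<^sup>2) + (\<Sum>k\<in>K. (c k - ?i f (e k))\<^sup>2)"
  proof -
    have "(\<Sum>k\<in>K. (c k - ?i f (e k))\<^sup>2)
        = (\<Sum>k\<in>K. (c k)\<^sup>2) + (\<Sum>k\<in>K. (?i f (e k))\<^sup>2) - 2 * (\<Sum>k\<in>K. c k * ?i f (e k))"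
      by (simp add: power2_diff sum.distrib sum_subtractf sum_distrib_left mult.assoc)
    then show ?thesis
      by (simp add: gf gg)
  qed
  finally show ?thesis .
qed

section \<open>The algebra spanned by the tensor polynomials\<close>

lemma degree_graded_expansion:
  fixes P :: "nat \<Rightarrow> 'a::field poly"
  assumes P: "\<And>k. degree (P k) = k" "\<And>k. P k \<noteq> 0" and p: "degree p \<le> n"
  shows "\<exists>c. p = (\<Sum>i\<le>n. smult (c i) (P i))"
  using p
proof (induction n arbitrary: p)
  case 0
  then obtain a where a: "p = [:a:]"
    by (meson degree_eq_zeroE le_zero_eq)
  obtain b where b: "P 0 = [:b:]"
    using P(1)[of 0] by (meson degree_eq_zeroE)
  then have "b \<noteq> 0"
    using P(2)[of 0] by auto
  then have "p = (\<Sum>i\<le>0. smult (a / b) (P i))"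
    by (simp add: a b)
  then show ?case
    by (rule exI[where x = "\<lambda>_. a / b"])
next
  case (Suc n)
  \<comment> \<open>Chosen to cancel the coefficient of degree \<open>Suc n\<close>, so that the
    induction hypothesis applies to the difference; \<open>d\<close> is 0 if \<open>p\<close>
    already has smaller degree.\<close>
  define d where "d = coeff p (Suc n) / lead_coeff (P (Suc n))"
  have nz: "coeff (P (Suc n)) (Suc n) \<noteq> 0"
    using P(2)[of "Suc n"] leading_coeff_neq_0[of "P (Suc n)"] by (simp add: P(1))
  have "degree (p - smult d (P (Suc n))) \<le> n"
  proof (rule degree_le, intro allI impI)
    fix i assume "n < i"
    then consider "i = Suc n" | "i > Suc n" by linarith
    then show "coeff (p - smult d (P (Suc n))) i = 0"
    proof cases
      case 1
      then show ?thesis using nz by (simp add: d_def P(1))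
    next
      case 2
      then show ?thesis using Suc.prems P(1)[of "Suc n"] by (simp add: coeff_eq_0)
    qed
  qed
  from Suc.IH[OF this] obtain c where c: "p - smult d (P (Suc n)) = (\<Sum>i\<le>n. smult (c i) (P i))"
    by blast
  have "p = (\<Sum>i\<le>n. smult (c i) (P i)) + smult d (P (Suc n))"
    unfolding c[symmetric] by simp
  also have "\<dots> = (\<Sum>i\<le>Suc n. smult ((c(Suc n := d)) i) (P i))"
    by (auto intro!: sum.cong)
  finally show ?case by blast
qed

text \<open>Each factor is expanded in the \<open>P i\<close> up to a common degree
  \<open>n\<close>; distributing the product over these sums leaves one tensor polynomial for each
  choice of indices.\<close>

lemma poly_prod_in_span_tensor_poly:
  fixes Q :: "'s::finite \<Rightarrow> real poly"
  assumes "\<And>k. degree (P k) = k" "\<And>k. P k \<noteq> 0"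
  shows "(\<lambda>x::real ^ 's. \<Prod>j\<in>UNIV. poly (Q j) (x $ j)) \<in> span (range (tensor_poly P))"
proof -
  define n where "n = Max (range (\<lambda>j. degree (Q j)))"
  have "\<exists>c. Q j = (\<Sum>i\<le>n. smult (c i) (P i))" for j
    using degree_graded_expansion[OF assms] by (simp add: n_def)
  then obtain c where c: "\<And>j. Q j = (\<Sum>i\<le>n. smult (c j i) (P i))"
    by metis
  let ?E = "(UNIV :: 's set) \<rightarrow>\<^sub>E {..n}"
  have "(\<lambda>x::real ^ 's. \<Prod>j\<in>UNIV. poly (Q j) (x $ j))
      = (\<Sum>g\<in>?E. (\<Prod>j\<in>UNIV. c j (g j)) *\<^sub>R tensor_poly P (vec_lambda g))"
  proof
    fix x :: "real ^ 's"
    have "(\<Prod>j\<in>UNIV. poly (Q j) (x $ j)) = (\<Prod>j\<in>UNIV. \<Sum>i\<le>n. c j i * poly (P i) (x $ j))"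
      by (simp add: c poly_sum)
    also have "\<dots> = (\<Sum>g\<in>?E. \<Prod>j\<in>UNIV. c j (g j) * poly (P (g j)) (x $ j))"
      by (subst prod_sum_PiE) auto
    finally show "(\<Prod>j\<in>UNIV. poly (Q j) (x $ j))
        = (\<Sum>g\<in>?E. (\<Prod>j\<in>UNIV. c j (g j)) *\<^sub>R tensor_poly P (vec_lambda g)) x"
      by (simp add: tensor_poly_def prod.distrib)
  qed
  also have "\<dots> \<in> span (range (tensor_poly P))"
    by (intro span_sum span_scale span_base rangeI)
  finally show ?thesis .
qed

lemma continuous_on_span_tensor_poly:
  assumes "f \<in> span (range (tensor_poly P))"
  shows "continuous_on S f"
  using assms
proof (induction rule: span_induct_alt)
  case base
  then show ?case by (simp add: zero_fun_def)
next
  case (step c f g)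
  then obtain k where k: "f = tensor_poly P k" by auto
  have "continuous_on S f"
    unfolding k tensor_poly_def by (intro continuous_intros)
  then show ?case
    using continuous_on_add[OF continuous_on_mult[OF continuous_on_const[of S c]], of f g] step(2)
    by (simp add: plus_fun_def scaleR_fun_def)
qed

text \<open>Multiplication is bilinear, so closure need only be known on generators: first one
  factor is extended to the span, then the other.\<close>

lemma span_mult_closed:
  fixes B :: "('a \<Rightarrow> real) set"
  assumes B: "\<And>f g. f \<in> B \<Longrightarrow> g \<in> B \<Longrightarrow> f * g \<in> span B"
    and f: "f \<in> span B" and g: "g \<in> span B"
  shows "f * g \<in> span B"
proof -
  have *: "b * g \<in> span B" if b: "b \<in> B" for b
    using g
  proof (induction rule: span_induct_alt)
    case base
    show ?case using span_zero[of B] by (simp add: zero_fun_def times_fun_def)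
  next
    case (step c h h')
    have eq: "b * (c *\<^sub>R h + h') = c *\<^sub>R (b * h) + b * h'"
      by (auto simp: fun_eq_iff algebra_simps)
    show ?case
      unfolding eq using step B[OF b] by (intro span_add span_scale)
  qed
  show ?thesis
    using f
  proof (induction rule: span_induct_alt)
    case base
    show ?case using span_zero[of B] by (simp add: zero_fun_def times_fun_def)
  next
    case (step c h h')
    have eq: "(c *\<^sub>R h + h') * g = c *\<^sub>R (h * g) + h' * g"
      by (auto simp: fun_eq_iff algebra_simps)
    show ?case
      unfolding eq using step * by (intro span_add span_scale)
  qed
qed

text \<open>These are the hypotheses of Stone-Weierstrass on the cube.\<close>

lemma function_ring_on_tensor_poly:
  assumes P: "\<And>k. degree (P k) = k" "\<And>k. P k \<noteq> 0"
  shows "function_ring_on (span (range (tensor_poly P)) :: (real ^ 's \<Rightarrow> real) set) cube"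
proof
  let ?R = "span (range (tensor_poly P)) :: (real ^ 's \<Rightarrow> real) set"
  show "compact (cube :: (real ^ 's) set)"
    by (rule compact_cube)
  show "continuous_on cube f" if "f \<in> ?R" for f
    using that by (rule continuous_on_span_tensor_poly)
  show "(\<lambda>x. f x + g x) \<in> ?R" if "f \<in> ?R" "g \<in> ?R" for f g
    using span_add[OF that] by (simp add: plus_fun_def)
  show "(\<lambda>x. f x * g x) \<in> ?R" if "f \<in> ?R" "g \<in> ?R" for f g
  proof -
    have "f * g \<in> ?R"
    proof (rule span_mult_closed[OF _ that])
      fix f g :: "real ^ 's \<Rightarrow> real"
      assume "f \<in> range (tensor_poly P)" "g \<in> range (tensor_poly P)"
      then obtain k l where kl: "f = tensor_poly P k" "g = tensor_poly P l"
        by auto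
      have "f * g = (\<lambda>x. \<Prod>j\<in>UNIV. poly (P (k $ j) * P (l $ j)) (x $ j))"
        by (simp add: kl fun_eq_iff tensor_poly_def prod.distrib)
      then show "f * g \<in> ?R"
        using poly_prod_in_span_tensor_poly[OF P, of "\<lambda>j. P (k $ j) * P (l $ j)"] by simp
    qed
    then show ?thesis by (simp add: times_fun_def)
  qed
  show "(\<lambda>_. c) \<in> ?R" for c
  proof -
    have "(\<lambda>_. 1) \<in> ?R"
      using poly_prod_in_span_tensor_poly[OF P, of "\<lambda>_. [:1:]"] by simp
    then have "c *\<^sub>R (\<lambda>_. 1) \<in> ?R"
      by (rule span_scale)
    then show ?thesis by (simp add: scaleR_fun_def)
  qed
  show "\<exists>f\<in>?R. f x \<noteq> f y" if xy: "x \<noteq> y" for x y :: "real ^ 's"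
  proof -
    obtain i where i: "x $ i \<noteq> y $ i"
      using xy by (auto simp: vec_eq_iff)
    \<comment> \<open>Points are separated by a coordinate function, written as a product with the
      identity in slot \<open>i\<close> and the constant 1 elsewhere.\<close>
    have "(\<Prod>j\<in>UNIV. poly (if j = i then [:0, 1:] else [:1:]) (z $ j)) = z $ i" for z :: "real ^ 's"
    proof -
      have "(\<Prod>j\<in>UNIV. poly (if j = i then [:0, 1:] else [:1:]) (z $ j))
          = (\<Prod>j\<in>UNIV. if j = i then z $ j else 1)"
        by (intro prod.cong) auto
      then show ?thesis by simp
    qed
    then have "(\<lambda>z. z $ i) \<in> ?R"
      using poly_prod_in_span_tensor_poly[OF P, of "\<lambda>j. if j = i then [:0, 1:] else [:1:]"] by simp
    with i show ?thesis
      by (intro bexI[of _ "\<lambda>z. z $ i"])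
  qed
qed

subsection \<open>Completeness of the tensor Jacobi polynomials\<close>

lemma L2w_inner_self:
  "f \<in> L2w \<alpha> \<beta> \<Longrightarrow> L2w_inner \<alpha> \<beta> f f = (LINT x|jacobi_measure \<alpha> \<beta>. (f x)\<^sup>2)"
  by (simp add: L2w_inner_eq L2w_iff power2_eq_square)

text \<open>Serves as a triangle inequality for squared norms, at the price of a factor 2 and
  without square roots.\<close>

lemma L2w_inner_self_add_le:
  assumes "f \<in> L2w \<alpha> \<beta>" "g \<in> L2w \<alpha> \<beta>"
  shows "L2w_inner \<alpha> \<beta> (f + g) (f + g) \<le> 2 * L2w_inner \<alpha> \<beta> f f + 2 * L2w_inner \<alpha> \<beta> g g"
proof -
  have fg: "f + g \<in> L2w \<alpha> \<beta>"
    by (intro subspace_add[OF subspace_L2w] assms)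
  have int: "integrable (jacobi_measure \<alpha> \<beta>) (\<lambda>x. (f x)\<^sup>2)" "integrable (jacobi_measure \<alpha> \<beta>) (\<lambda>x. (g x)\<^sup>2)"
    "integrable (jacobi_measure \<alpha> \<beta>) (\<lambda>x. (f x + g x)\<^sup>2)"
    using assms fg by (simp_all add: L2w_iff)
  have "(f x + g x)\<^sup>2 \<le> 2 * (f x)\<^sup>2 + 2 * (g x)\<^sup>2" for x
    using sum_squares_bound[of "f x" "g x"] by (simp add: power2_sum)
  then have "(LINT x|jacobi_measure \<alpha> \<beta>. (f x + g x)\<^sup>2)
      \<le> (LINT x|jacobi_measure \<alpha> \<beta>. 2 * (f x)\<^sup>2 + 2 * (g x)\<^sup>2)"
    using int by (intro integral_mono) auto
  then show ?thesis
    using int assms fg by (simp add: L2w_inner_self)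
qed

lemma space_jacobi_measure: "space (jacobi_measure \<alpha> \<beta>) = cube"
  by (simp add: jacobi_measure_def space_restrict_space)

text \<open>Over a finite measure a uniform bound controls the weighted norm; this converts the
  uniform approximation of Stone-Weierstrass into approximation in \<open>L2w\<close>.\<close>

lemma bounded_L2w:
  fixes f :: "real ^ 's \<Rightarrow> real"
  assumes "finite_measure (jacobi_measure \<alpha> \<beta> :: (real ^ 's) measure)"
    and f: "f \<in> borel_measurable (jacobi_measure \<alpha> \<beta>)" and B: "\<And>x. x \<in> cube \<Longrightarrow> \<bar>f x\<bar> \<le> B"
  shows "f \<in> L2w \<alpha> \<beta>"
    and "L2w_inner \<alpha> \<beta> f f \<le> B\<^sup>2 * measure (jacobi_measure \<alpha> \<beta>) (cube :: (real ^ 's) set)"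
proof -
  interpret finite_measure "jacobi_measure \<alpha> \<beta> :: (real ^ 's) measure" by fact
  have sq: "(f x)\<^sup>2 \<le> B\<^sup>2" if "x \<in> cube" for x
    using B[OF that] by (rule abs_le_square_iff[THEN iffD1, of "f x" B, OF order_trans[OF _ abs_ge_self]])
  have "integrable (jacobi_measure \<alpha> \<beta>) (\<lambda>x. (f x)\<^sup>2)"
    using f sq by (intro integrable_const_bound[of _ "B\<^sup>2"] AE_I2) (auto simp: space_jacobi_measure)
  then show L: "f \<in> L2w \<alpha> \<beta>"
    using f by (simp add: L2w_iff)
  have "L2w_inner \<alpha> \<beta> f f \<le> (LINT x|(jacobi_measure \<alpha> \<beta> :: (real ^ 's) measure). B\<^sup>2)"
    unfolding L2w_inner_self[OF L] using L sq
    by (intro integral_mono) (auto simp: L2w_iff space_jacobi_measure)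
  then show "L2w_inner \<alpha> \<beta> f f \<le> B\<^sup>2 * measure (jacobi_measure \<alpha> \<beta>) (cube :: (real ^ 's) set)"
    by (simp add: space_jacobi_measure mult.commute)
qed

lemma continuous_imp_jacobi_measurable:
  "continuous_on UNIV f \<Longrightarrow> f \<in> borel_measurable (jacobi_measure \<alpha> \<beta>)"
  unfolding jacobi_measure_measurable_iff
  by (intro measurable_restrict_space1 measurable_completion)
     (simp add: borel_measurable_continuous_onI)

definition clip :: "real \<Rightarrow> real \<Rightarrow> real" where
  "clip B y = max (- B) (min B y)"

lemma abs_clip_le: "B \<ge> 0 \<Longrightarrow> \<bar>clip B y\<bar> \<le> B"
  by (auto simp: clip_def)

lemma clip_id: "\<bar>y\<bar> \<le> B \<Longrightarrow> clip B y = y"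
  by (auto simp: clip_def)

lemma abs_diff_clip_le: "B \<ge> 0 \<Longrightarrow> \<bar>y - clip B y\<bar> \<le> \<bar>y\<bar>"
  by (auto simp: clip_def)

lemma tendsto_clip: "(f \<longlongrightarrow> y) F \<Longrightarrow> ((\<lambda>x. clip B (f x)) \<longlongrightarrow> clip B y) F"
  unfolding clip_def by (intro tendsto_intros)

text \<open>Extended by zero, \<open>f\<close> is Lebesgue measurable and hence an almost-everywhere
  limit of continuous functions. Clipping these at \<open>B\<close> keeps continuity and the limit,
  and provides the bound for dominated convergence.\<close>

lemma bounded_approx_continuous:
  fixes f :: "real ^ 's \<Rightarrow> real"
  assumes fin: "finite_measure (jacobi_measure \<alpha> \<beta> :: (real ^ 's) measure)"
    and f: "f \<in> borel_measurable (jacobi_measure \<alpha> \<beta>)"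
    and B: "\<And>x. x \<in> cube \<Longrightarrow> \<bar>f x\<bar> \<le> B" "B \<ge> 0" and "e > 0"
  obtains g where "continuous_on UNIV g" "g \<in> L2w \<alpha> \<beta>" "L2w_inner \<alpha> \<beta> (f - g) (f - g) < e"
proof -
  let ?M = "jacobi_measure \<alpha> \<beta> :: (real ^ 's) measure"
  interpret finite_measure ?M by fact
  have "(\<lambda>x. if x \<in> cube then f x else 0) \<in> borel_measurable lebesgue"
    using f by (simp add: jacobi_measure_measurable_iff borel_measurable_if)
  then have "(\<lambda>x. if x \<in> cube then f x else 0) measurable_on UNIV"
    by (rule lebesgue_measurable_imp_measurable_on) simp
  then obtain N g where N: "negligible N" and g: "\<And>n. continuous_on UNIV (g n)"
    and lim: "\<And>x. x \<notin> N \<Longrightarrow> (\<lambda>n. g n x) \<longlonglongrightarrow> (if x \<in> cube then f x else 0)"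
    unfolding measurable_on_def by auto
  define h where "h n x = clip B (g n x)" for n x
  have h: "continuous_on UNIV (h n)" for n
    unfolding h_def clip_def using g by (intro continuous_intros) auto
  have hm: "h n \<in> borel_measurable ?M" for n
    using h by (rule continuous_imp_jacobi_measurable)
  have hb: "\<bar>h n x\<bar> \<le> B" for n x
    using B(2) by (simp add: h_def abs_clip_le)
  have L: "f \<in> L2w \<alpha> \<beta>" "h n \<in> L2w \<alpha> \<beta>" for n
    using bounded_L2w(1)[OF fin] f hm B(1) hb by blast+
  \<comment> \<open>The exceptional null set is carried from Lebesgue measure to the cube and then
    through the density.\<close>
  have "AE x in lebesgue. x \<notin> N"
    using N by (simp add: negligible_iff_null_sets AE_not_in)
  then have "AE x in lebesgue_on cube. x \<notin> N"
    by (subst AE_restrict_space_iff) auto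
  then have "AE x in ?M. x \<notin> N"
    unfolding jacobi_measure_def by (subst AE_density) auto
  then have conv: "AE x in ?M. (\<lambda>n. (f x - h n x)\<^sup>2) \<longlonglongrightarrow> 0"
  proof (rule AE_mp, intro AE_I2 impI)
    fix x assume x: "x \<in> space ?M" "x \<notin> N"
    then have "(\<lambda>n. h n x) \<longlonglongrightarrow> clip B (f x)"
      using tendsto_clip[OF lim[of x], of B] by (simp add: h_def space_jacobi_measure)
    then have "(\<lambda>n. (f x - h n x)\<^sup>2) \<longlonglongrightarrow> (f x - clip B (f x))\<^sup>2"
      by (intro tendsto_intros)
    then show "(\<lambda>n. (f x - h n x)\<^sup>2) \<longlonglongrightarrow> 0"
      using x B(1) by (simp add: clip_id space_jacobi_measure)
  qed
  have "(\<lambda>n. LINT x|?M. (f x - h n x)\<^sup>2) \<longlonglongrightarrow> (LINT x|?M. 0)"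
  proof (rule integral_dominated_convergence[where w = "\<lambda>_. (2 * B)\<^sup>2", OF _ _ _ conv])
    show "(\<lambda>x. (f x - h n x)\<^sup>2) \<in> borel_measurable ?M" for n
      using f hm by measurable
    show "AE x in ?M. norm ((f x - h n x)\<^sup>2) \<le> (2 * B)\<^sup>2" for n
    proof (rule AE_I2)
      fix x assume "x \<in> space ?M"
      then have "\<bar>f x - h n x\<bar> \<le> \<bar>2 * B\<bar>"
        using B(1)[of x] hb[of n x] by (auto simp: space_jacobi_measure)
      then show "norm ((f x - h n x)\<^sup>2) \<le> (2 * B)\<^sup>2"
        by (simp add: abs_le_square_iff)
    qed
  qed auto
  moreover have "L2w_inner \<alpha> \<beta> (f - h n) (f - h n) = (LINT x|?M. (f x - h n x)\<^sup>2)" for n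
    using L by (subst L2w_inner_self) (auto intro: subspace_diff[OF subspace_L2w])
  ultimately have "(\<lambda>n. L2w_inner \<alpha> \<beta> (f - h n) (f - h n)) \<longlonglongrightarrow> 0"
    by simp
  then have "eventually (\<lambda>n. L2w_inner \<alpha> \<beta> (f - h n) (f - h n) < e) sequentially"
    using \<open>e > 0\<close> by (rule order_tendstoD)
  then obtain n where "L2w_inner \<alpha> \<beta> (f - h n) (f - h n) < e"
    by (auto simp: eventually_sequentially)
  then show ?thesis
    using that[of "h n"] h L by blast
qed

text \<open>At each point the truncation at level \<open>n\<close> eventually equals
  \<open>f\<close>, and the squared error is dominated by the integrable function
  \<open>(f x)\<^sup>2\<close>.\<close>

lemma L2w_approx_bounded:
  fixes f :: "real ^ 's \<Rightarrow> real"
  assumes f: "f \<in> L2w \<alpha> \<beta>" and "e > 0"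
  obtains B where "B \<ge> 0"
    "L2w_inner \<alpha> \<beta> (f - (\<lambda>x. clip B (f x))) (f - (\<lambda>x. clip B (f x))) < e"
proof -
  let ?M = "jacobi_measure \<alpha> \<beta> :: (real ^ 's) measure"
  have [measurable]: "f \<in> borel_measurable ?M" and int: "integrable ?M (\<lambda>x. (f x)\<^sup>2)"
    using f by (auto simp: L2w_iff)
  define h where "h n x = clip (real n) (f x)" for n x
  have [measurable]: "h n \<in> borel_measurable ?M" for n
    unfolding h_def clip_def by measurable
  have le: "(f x - h n x)\<^sup>2 \<le> (f x)\<^sup>2" for n x
    unfolding abs_le_square_iff[symmetric] h_def by (rule abs_diff_clip_le) simp
  have conv: "AE x in ?M. (\<lambda>n. (f x - h n x)\<^sup>2) \<longlonglongrightarrow> 0"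
  proof (rule AE_I2)
    fix x
    obtain m :: nat where m: "\<bar>f x\<bar> \<le> real m"
      using real_arch_simple by blast
    then have "f x - h n x = 0" if "n \<ge> m" for n
      using that by (simp add: h_def clip_id)
    then have "eventually (\<lambda>n. (f x - h n x)\<^sup>2 = 0) sequentially"
      unfolding eventually_sequentially by fastforce
    then show "(\<lambda>n. (f x - h n x)\<^sup>2) \<longlonglongrightarrow> 0"
      by (rule tendsto_eventually)
  qed
  have lim: "(\<lambda>n. LINT x|?M. (f x - h n x)\<^sup>2) \<longlonglongrightarrow> (LINT x|?M. 0)"
    by (rule integral_dominated_convergence[OF _ _ int conv]) (use le in auto)
  have "L2w_inner \<alpha> \<beta> (f - h n) (f - h n) = (LINT x|?M. (f x - h n x)\<^sup>2)" for n
    by (subst L2w_inner_eq) (auto simp: fun_diff_def power2_eq_square)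
  with lim have "(\<lambda>n. L2w_inner \<alpha> \<beta> (f - h n) (f - h n)) \<longlonglongrightarrow> 0"
    by simp
  then have "eventually (\<lambda>n. L2w_inner \<alpha> \<beta> (f - h n) (f - h n) < e) sequentially"
    using \<open>e > 0\<close> by (rule order_tendstoD)
  then obtain n where "L2w_inner \<alpha> \<beta> (f - h n) (f - h n) < e"
    by (auto simp: eventually_sequentially)
  moreover have "h n = (\<lambda>x. clip (real n) (f x))"
    by (simp add: h_def fun_eq_iff)
  ultimately show ?thesis
    using that[of "real n"] by simp
qed

lemma jacobi_poly_degree:
  assumes "orthonormal_jacobi_polys \<alpha> \<beta> P"
  shows "degree (P k) = k" "P k \<noteq> 0"
proof -
  have "degree (P k) = k" "lead_coeff (P k) > 0"
    using assms unfolding orthonormal_jacobi_polys_def by blast+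
  then show "degree (P k) = k" "P k \<noteq> 0" by auto
qed

text \<open>Three successive approximations: \<open>f\<close> by its truncation \<open>u\<close>,
  \<open>u\<close> by a continuous \<open>g\<close>, and \<open>g\<close> uniformly on the cube by a
  polynomial \<open>p\<close>.\<close>

lemma span_tensor_poly_dense_L2w:
  fixes f :: "real ^ 's \<Rightarrow> real"
  assumes P: "orthonormal_jacobi_polys \<alpha> \<beta> P" and f: "f \<in> L2w \<alpha> \<beta>" and "e > 0"
  obtains p where "p \<in> span (range (tensor_poly P))" "L2w_inner \<alpha> \<beta> (f - p) (f - p) < e"
proof -
  let ?M = "jacobi_measure \<alpha> \<beta> :: (real ^ 's) measure"
  let ?Q = "\<lambda>f :: real ^ 's \<Rightarrow> real. L2w_inner \<alpha> \<beta> f f"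
  have fin: "finite_measure ?M"
    by (rule finite_measure_jacobi_measure[OF jacobi_weight1_integrable[OF P]])
  have sub: "u - v \<in> L2w \<alpha> \<beta>" if "u \<in> L2w \<alpha> \<beta>" "v \<in> L2w \<alpha> \<beta>" for u v :: "real ^ 's \<Rightarrow> real"
    using that by (rule subspace_diff[OF subspace_L2w])
  have tri: "?Q (u - w) \<le> 2 * ?Q (u - v) + 2 * ?Q (v - w)"
    if "u \<in> L2w \<alpha> \<beta>" "v \<in> L2w \<alpha> \<beta>" "w \<in> L2w \<alpha> \<beta>" for u v w :: "real ^ 's \<Rightarrow> real"
    using L2w_inner_self_add_le[OF sub[OF that(1,2)] sub[OF that(2,3)]] by simp
  \<comment> \<open>Error budget: two uses of \<open>tri\<close> bound the total by
    \<open>2 * (e / 4) + 4 * (e / 16) + 4 * (e / 16) = e\<close>.\<close>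
  obtain B where B: "B \<ge> 0" "?Q (f - (\<lambda>x. clip B (f x))) < e / 4"
    using L2w_approx_bounded[OF f, of "e / 4"] \<open>e > 0\<close> by auto
  define u where "u = (\<lambda>x. clip B (f x))"
  have um: "u \<in> borel_measurable ?M"
    using f unfolding u_def clip_def by (auto simp: L2w_iff)
  have ub: "\<bar>u x\<bar> \<le> B" for x
    using B(1) by (simp add: u_def abs_clip_le)
  have u: "u \<in> L2w \<alpha> \<beta>"
    using bounded_L2w(1)[OF fin um ub] .
  obtain g where g: "continuous_on UNIV g" "g \<in> L2w \<alpha> \<beta>" "?Q (u - g) < e / 16"
    using bounded_approx_continuous[OF fin um ub B(1), of "e / 16"] \<open>e > 0\<close> by auto
  define m where "m = measure ?M cube"
  have m: "m \<ge> 0"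
    by (simp add: m_def)
  \<comment> \<open>Makes \<open>d\<^sup>2 * m\<close> smaller than \<open>e / 16\<close>; the
    summand 1 covers \<open>m = 0\<close> and keeps the inequality strict.\<close>
  define d where "d = sqrt (e / (16 * (m + 1)))"
  have d: "d > 0" "d\<^sup>2 = e / (16 * (m + 1))"
    using \<open>e > 0\<close> m by (simp_all add: d_def)
  interpret function_ring_on "span (range (tensor_poly P)) :: (real ^ 's \<Rightarrow> real) set" cube
    by (rule function_ring_on_tensor_poly) (rule jacobi_poly_degree[OF P])+
  obtain p where p: "p \<in> span (range (tensor_poly P))" "\<And>x. x \<in> cube \<Longrightarrow> \<bar>g x - p x\<bar> < d"
    using Stone_Weierstrass_basic[OF continuous_on_subset[OF g(1) subset_UNIV] d(1)] by blast
  have "continuous_on UNIV (g - p)"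
    using g(1) continuous_on_span_tensor_poly[OF p(1)]
    by (auto simp: fun_diff_def intro: continuous_on_diff)
  then have gpm: "g - p \<in> borel_measurable ?M"
    by (rule continuous_imp_jacobi_measurable)
  have gp_le: "\<bar>(g - p) x\<bar> \<le> d" if "x \<in> cube" for x
    using p(2)[OF that] by simp
  have "?Q (g - p) \<le> d\<^sup>2 * m"
    unfolding m_def using fin gpm gp_le by (rule bounded_L2w(2))
  also have "\<dots> < e / 16"
    using \<open>e > 0\<close> m by (simp add: d field_simps)
  finally have gp: "?Q (g - p) < e / 16" .
  have pL: "p \<in> L2w \<alpha> \<beta>"
  proof -
    have "g - p \<in> L2w \<alpha> \<beta>"
      using fin gpm gp_le by (rule bounded_L2w(1))
    from sub[OF g(2) this] show ?thesis
      by (simp only: diff_diff_eq2 add_diff_cancel_left')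
  qed
  have "?Q (f - p) < e"
    using tri[OF f u pL] tri[OF u g(2) pL] B(2) g(3) gp by (simp add: u_def)
  then show ?thesis
    using that p(1) by blast
qed

text \<open>Parseval for the tail in finite form: up to \<open>e\<close>, the residual is bounded by
  finitely many squared coefficients outside \<open>G\<close>. Density supplies a polynomial, and
  \<open>K\<close> consists of its indices not in \<open>G\<close>.\<close>

lemma tensor_poly_residual_le:
  fixes f :: "real ^ 's \<Rightarrow> real" and G :: "(nat ^ 's) set"
  assumes P: "orthonormal_jacobi_polys \<alpha> \<beta> P" and f: "f \<in> L2w \<alpha> \<beta>" and G: "finite G" and "e > 0"
  obtains K where "finite K" "K \<inter> G = {}"
    "L2w_inner \<alpha> \<beta> (f - (\<Sum>k\<in>G. jacobi_coeff \<alpha> \<beta> P f k *\<^sub>R tensor_poly P k))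
        (f - (\<Sum>k\<in>G. jacobi_coeff \<alpha> \<beta> P f k *\<^sub>R tensor_poly P k))
       < (\<Sum>k\<in>K. (jacobi_coeff \<alpha> \<beta> P f k)\<^sup>2) + e"
proof -
  let ?b = "jacobi_coeff \<alpha> \<beta> P f"
  note residual = L2w_inner_residual[OF f tensor_poly_L2w[OF P] tensor_poly_inner(2)[OF P],
      folded jacobi_coeff_def]
  obtain p where p: "p \<in> span (range (tensor_poly P))" "L2w_inner \<alpha> \<beta> (f - p) (f - p) < e"
    using span_tensor_poly_dense_L2w[OF P f \<open>e > 0\<close>] .
  obtain A c where A: "finite A" "A \<subseteq> range (tensor_poly P)" "p = (\<Sum>a\<in>A. c a *\<^sub>R a)"
    using p(1) unfolding span_explicit by blast
  \<comment> \<open>Picks one multi-index for each function in \<open>A\<close>, so that the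
    combination can be reindexed over \<open>F\<close>.\<close>
  obtain F where F: "inj_on (tensor_poly P) F" "A = tensor_poly P ` F"
    using A(2) by (meson subset_image_inj)
  have "finite F"
    using A(1) F by (simp add: finite_image_iff)
  have "p = (\<Sum>k\<in>F. c (tensor_poly P k) *\<^sub>R tensor_poly P k)"
    unfolding A(3) F(2) by (simp add: sum.reindex[OF F(1)])
  with p(2) residual[OF \<open>finite F\<close>, of "\<lambda>k. c (tensor_poly P k)"]
  have "L2w_inner \<alpha> \<beta> f f - (\<Sum>k\<in>F. (?b k)\<^sup>2)
      + (\<Sum>k\<in>F. (c (tensor_poly P k) - ?b k)\<^sup>2) < e"
    by simp
  moreover have "(\<Sum>k\<in>F. (c (tensor_poly P k) - ?b k)\<^sup>2) \<ge> 0"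
    by (simp add: sum_nonneg)
  moreover have "(\<Sum>k\<in>F. (?b k)\<^sup>2) \<le> (\<Sum>k\<in>G \<union> (F - G). (?b k)\<^sup>2)"
    using G \<open>finite F\<close> by (intro sum_mono2) auto
  moreover have "(\<Sum>k\<in>G \<union> (F - G). (?b k)\<^sup>2) = (\<Sum>k\<in>G. (?b k)\<^sup>2) + (\<Sum>k\<in>F - G. (?b k)\<^sup>2)"
    using G \<open>finite F\<close> by (intro sum.union_disjoint) auto
  ultimately have "L2w_inner \<alpha> \<beta> f f - (\<Sum>k\<in>G. (?b k)\<^sup>2) < (\<Sum>k\<in>F - G. (?b k)\<^sup>2) + e"
    by linarith
  then show ?thesis
    using that[of "F - G"] residual[OF G, of ?b] \<open>finite F\<close> by auto
qed

subsection \<open>The width bound\<close>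

text \<open>Off the cross the weight exceeds \<open>T\<close>, so each squared coefficient is at
  most \<open>T powr (- (2 * r))\<close> times its term in the squared \<open>K_norm\<close>, and
  those terms sum to at most 1. The slack \<open>e\<close> is then sent to 0.\<close>

lemma hyperbolic_cross_residual_le:
  fixes f :: "real ^ 's \<Rightarrow> real"
  assumes P: "orthonormal_jacobi_polys \<alpha> \<beta> P" and f: "f \<in> K_ball r a \<alpha> \<beta> P"
    and "r > 0" "T > 0" and G: "finite {k :: nat ^ 's. hyp_weight a k \<le> T}"
  shows "L2w_norm \<alpha> \<beta> (f - (\<Sum>k | hyp_weight a k \<le> T. jacobi_coeff \<alpha> \<beta> P f k *\<^sub>R tensor_poly P k))
      \<le> T powr (- r)"
proof -
  let ?b = "jacobi_coeff \<alpha> \<beta> P f"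
  let ?h = "f - (\<Sum>k | hyp_weight a k \<le> T. ?b k *\<^sub>R tensor_poly P k)"
  let ?s = "\<lambda>k :: nat ^ 's. hyp_weight a k powr (2 * r) * \<bar>?b k\<bar>\<^sup>2"
  have fL: "f \<in> L2w \<alpha> \<beta>" and summable: "?s summable_on UNIV"
    and norm: "K_norm r a \<alpha> \<beta> P f \<le> 1"
    using f by (auto simp: K_ball_def K_space_def)
  have total: "(\<Sum>\<^sub>\<infinity>k. ?s k) \<le> 1"
    using norm unfolding K_norm_def real_sqrt_le_1_iff .
  have "L2w_inner \<alpha> \<beta> ?h ?h \<le> T powr (- (2 * r)) + e" if e: "e > 0" for e
  proof -
    obtain K where K: "finite K" "K \<inter> {k. hyp_weight a k \<le> T} = {}"
        "L2w_inner \<alpha> \<beta> ?h ?h < (\<Sum>k\<in>K. (?b k)\<^sup>2) + e"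
      using tensor_poly_residual_le[OF P fL G e] .
    have "(\<Sum>k\<in>K. (?b k)\<^sup>2) \<le> (\<Sum>k\<in>K. T powr (- (2 * r)) * ?s k)"
    proof (rule sum_mono)
      fix k assume "k \<in> K"
      then have "T powr (2 * r) \<le> hyp_weight a k powr (2 * r)"
        using K(2) \<open>T > 0\<close> \<open>r > 0\<close> by (intro powr_mono2) auto
      then have "(?b k)\<^sup>2 * T powr (2 * r) \<le> (?b k)\<^sup>2 * hyp_weight a k powr (2 * r)"
        by (rule mult_left_mono) simp
      then show "(?b k)\<^sup>2 \<le> T powr (- (2 * r)) * ?s k"
        using \<open>T > 0\<close> unfolding powr_minus_divide by (simp add: field_simps)
    qed
    also have "\<dots> \<le> T powr (- (2 * r)) * (\<Sum>\<^sub>\<infinity>k. ?s k)"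
      unfolding sum_distrib_left[symmetric]
      by (intro mult_left_mono finite_sum_le_infsum summable K(1)) auto
    also have "\<dots> \<le> T powr (- (2 * r))"
      using mult_left_mono[OF total, of "T powr (- (2 * r))"] by simp
    finally show ?thesis
      using K(3) by simp
  qed
  then have "L2w_inner \<alpha> \<beta> ?h ?h \<le> T powr (- (2 * r))"
    by (rule field_le_epsilon)
  also have "\<dots> = (T powr (- r))\<^sup>2"
    by (simp add: power2_eq_square powr_add[symmetric])
  finally show ?thesis
    unfolding L2w_norm_def by (intro real_le_lsqrt) simp_all
qed

text \<open>The witness subspace is spanned by the tensor polynomials of the cross, and each
  \<open>f\<close> in the ball is approximated by its partial sum.\<close>

lemma kolmogorov_width_K_ball_le:
  fixes P :: "nat \<Rightarrow> real poly"
  assumes P: "orthonormal_jacobi_polys \<alpha> \<beta> P" and "r > 0" "T > 0"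
    and G: "finite {k :: nat ^ 's. hyp_weight a k \<le> T}" "card {k :: nat ^ 's. hyp_weight a k \<le> T} \<le> N"
  shows "kolmogorov_width N (K_ball r a \<alpha> \<beta> P :: (real ^ 's \<Rightarrow> real) set) (L2w \<alpha> \<beta>) (L2w_norm \<alpha> \<beta>)
      \<le> ereal (T powr (- r))"
  unfolding kolmogorov_width_def
proof (rule INF_lower2)
  let ?B = "tensor_poly P ` {k :: nat ^ 's. hyp_weight a k \<le> T}"
  have "span ?B \<subseteq> L2w \<alpha> \<beta>"
    using tensor_poly_L2w[OF P] by (intro span_minimal subspace_L2w) auto
  moreover have "card ?B \<le> N"
    using card_image_le[OF G(1)] G(2) le_trans by blast
  ultimately show "span ?B \<in> {L. L \<subseteq> L2w \<alpha> \<beta> \<and> subspace L \<and> (\<exists>B. finite B \<and> card B \<le> N \<and> span B = L)}"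
    using G(1) by blast
  show "(SUP f\<in>K_ball r a \<alpha> \<beta> P. INF g\<in>span ?B. ereal (L2w_norm \<alpha> \<beta> (f - g))) \<le> ereal (T powr (- r))"
  proof (rule SUP_least)
    fix f :: "real ^ 's \<Rightarrow> real" assume f: "f \<in> K_ball r a \<alpha> \<beta> P"
    show "(INF g\<in>span ?B. ereal (L2w_norm \<alpha> \<beta> (f - g))) \<le> ereal (T powr (- r))"
    proof (rule INF_lower2)
      show "(\<Sum>k | hyp_weight a k \<le> T. jacobi_coeff \<alpha> \<beta> P f k *\<^sub>R tensor_poly P k) \<in> span ?B"
        by (intro span_sum span_scale span_base imageI) auto
    qed (use hyperbolic_cross_residual_le[OF P f assms(2,3) G(1)] in simp)
  qed
qed

theorem theorem6p5:
  fixes \<alpha> \<beta> a r q lam :: real and N :: nat and P :: "nat \<Rightarrow> real poly"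
  assumes "\<alpha> > -1" and "\<beta> > -1"
    and "a = (\<alpha> + \<beta> + 1) / 2" and "a > 0"
    and "orthonormal_jacobi_polys \<alpha> \<beta> P"
    and "r > 0"
    and "q \<ge> 1" and "lam = a - 1 / q" and "lam > 0"
    and "N \<ge> 1"
  shows "kolmogorov_width N (K_ball r a \<alpha> \<beta> P :: (real ^ 's \<Rightarrow> real) set)
           (L2w \<alpha> \<beta>) (L2w_norm \<alpha> \<beta>)
         \<le> ereal (2 powr r * q powr (r / (1 + q))
              * lam powr (- (q * r / (1 + q)) * real CARD('s))
              * real N powr (- (r / (1 + q))))"
proof -
  \<comment> \<open>The value wanted for \<open>T powr (1 + q)\<close>: it balances the factor
    \<open>lam powr (- (q * real CARD('s)))\<close> of the counting bound against
    \<open>N\<close>.\<close>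
  define D where "D = real N * lam powr (q * real CARD('s))"
  define T where "T = D powr (1 / (1 + q))"
  have "D > 0"
    using assms by (simp add: D_def)
  then have "T > 0"
    by (simp add: T_def)
  have a: "a > 1 / q"
    using assms by simp
  have "T powr (1 + q) = D"
    using \<open>D > 0\<close> assms by (simp add: T_def powr_powr)
  then have "real (card {k :: nat ^ 's. hyp_weight a k \<le> T}) \<le> D * lam powr (- (q * real CARD('s)))"
    using card_hyperbolic_cross(2)[OF assms(7) a, of T, where 's = 's]
    by (simp only: assms(8))
  also have "\<dots> = real N"
    using assms unfolding D_def powr_minus_divide by simp
  finally have card: "card {k :: nat ^ 's. hyp_weight a k \<le> T} \<le> N"
    by simp
  have "T powr (- r) = D powr (- (r / (1 + q)))"
    by (simp add: T_def powr_powr)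
  also have "\<dots> = lam powr (- (q * r / (1 + q)) * real CARD('s)) * real N powr (- (r / (1 + q)))"
    using assms by (simp add: D_def powr_mult powr_powr mult_ac)
  also have "\<dots> \<le> 2 powr r * q powr (r / (1 + q))
      * (lam powr (- (q * r / (1 + q)) * real CARD('s)) * real N powr (- (r / (1 + q))))"
  proof -
    have "1 * 1 \<le> 2 powr r * q powr (r / (1 + q))"
      using assms by (intro mult_mono ge_one_powr_ge_zero) auto
    then show ?thesis
      using mult_right_mono[of 1 "2 powr r * q powr (r / (1 + q))"] by simp
  qed
  finally have "T powr (- r) \<le> 2 powr r * q powr (r / (1 + q))
      * lam powr (- (q * r / (1 + q)) * real CARD('s)) * real N powr (- (r / (1 + q)))"
    by (simp add: mult.assoc)
  then show ?thesis
    using kolmogorov_width_K_ball_le[OF assms(5,6) \<open>T > 0\<close>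
        card_hyperbolic_cross(1)[OF assms(7) a] card]
    by (meson ereal_less_eq(3) order_trans)
qed

end
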